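(* Let $(X,\Sigma)$ be a measurable space and let $(r_n)_{n\geq0}$ be a strictly increasing sequence of nonnegative integers. Let $\mathfrak{R}:X^\infty\to X^\infty$ be the associated restriction map $(x_0,x_1,\ldots)\mapsto(x_{r_0},x_{r_1},\ldots)$. Suppose that there exists an integer $k\geq1$ such that $r_n\leq(n+1)k-1$ for every $n\geq0$. Then for any probability measure $\mu$ on $(X^\infty,\Sigma^\infty)$, $$H^{ip}(\mathfrak{R}_*\mu)\leq k\,H^{ip}(\mu),$$ where $\mathfrak{R}_*\mu$ is the push-forward of $\mu$ under $\mathfrak{R}$.
   Context: Let $(X,\Sigma)$ be a measurable space; $X^\infty=\prod_{n=0}^\infty X$ carries the product $\sigma$-algebra $\Sigma^\infty$. A partition of a measurable space is a finite collection of pairwise disjoint measurable sets whose union is the whole space. For a probability measure $\nu$ and a partition $\mathcal{P}=\{A_i\}_{i=1}^k$, the Shannon entropy is $H^{sh}(\nu,\mathcal{P})=-\sum_{i=1}^k\nu(A_i)\log\nu(A_i)$ (with $0\log 0=0$). For $A_0,\ldots,A_{n-1}\in\Sigma$ put $\overline{A_0\cdots A_{n-1}}=A_0\times\cdots\times A_{n-1}\times X\times X\times\cdots\subseteq X^\infty$; for a partition $\mathcal{P}=\{A_i\}_{i\in I}$ of $X$ let $\overline{\mathcal{P}}^n=\{\overline{A_{i_0}\cdots A_{i_{n-1}}}:i_0,\ldots,i_{n-1}\in I\}$, a partition of $X^\infty$. For a probability measure $\mu$ on $(X^\infty,\Sigma^\infty)$, the infinite-product entropy is defined by $H^{ip}(\mu,\mathcal{P})=\limsup_{n\to\infty}\frac1n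 H^{sh}(\mu,\overline{\mathcal{P}}^n)$ and $H^{ip}(\mu)=\sup_{\mathcal{P}}H^{ip}(\mu,\mathcal{P})\in[0,\infty]$, the supremum over all partitions $\mathcal{P}$ of $X$. *)

theory Defs
  imports "HOL-Probability.Probability"
begin

text \<open>
  The measurable space \<open>(X, \<Sigma>)\<close> is a value \<open>X :: 'a measure\<close> of which only \<^term>\<open>space X\<close> and
  \<^term>\<open>sets X\<close> are used. A probability measure \<open>\<mu>\<close> on a measurable space \<open>M\<close> is a \<open>\<mu>\<close> with
  \<^term>\<open>prob_space \<mu>\<close> and \<^term>\<open>sets \<mu> = sets M\<close>.
\<close>

abbreviation seq_space :: "'a measure \<Rightarrow> (nat \<Rightarrow> 'a) measure" where
  "seq_space X \<equiv> \<Pi>\<^sub>M n\<in>UNIV. X"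

text \<open>
  Unlike the library's \<^const>\<open>partition_on\<close>, this allows the empty set as a member, so that cylinder
  partitions, whose members may be empty, need no pruning.
\<close>

definition measurable_partition :: "'a measure \<Rightarrow> 'a set set \<Rightarrow> bool" where
  "measurable_partition M P \<longleftrightarrow> finite P \<and> P \<subseteq> sets M \<and> disjoint P \<and> \<Union>P = space M"

text \<open>
  Natural logarithm; the convention \<open>0 log 0 = 0\<close> holds automatically. Summing over the set of
  members agrees with summing over an indexed family, since disjoint members coincide only when empty.
\<close>

definition shannon_entropy :: "'a measure \<Rightarrow> 'a set set \<Rightarrow> real" where
  "shannon_entropy \<nu> P = - (\<Sum>A\<in>P. measure \<nu> A * ln (measure \<nu> A))"

definition cylinder :: "'a measure \<Rightarrow> nat \<Rightarrow> (nat \<Rightarrow> 'a set) \<Rightarrow> (nat \<Rightarrow> 'a) set" where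
  "cylinder X n A = (\<Pi>\<^sub>E i\<in>UNIV. if i < n then A i else space X)"

definition cylinder_partition :: "'a measure \<Rightarrow> nat \<Rightarrow> 'a set set \<Rightarrow> (nat \<Rightarrow> 'a) set set" where
  "cylinder_partition X n P = {cylinder X n A | A. \<forall>i<n. A i \<in> P}"

definition ip_entropy_partition ::
    "'a measure \<Rightarrow> (nat \<Rightarrow> 'a) measure \<Rightarrow> 'a set set \<Rightarrow> ereal" where
  "ip_entropy_partition X \<mu> P =
     limsup (\<lambda>n. ereal (1 / real n * shannon_entropy \<mu> (cylinder_partition X n P)))"

definition ip_entropy :: "'a measure \<Rightarrow> (nat \<Rightarrow> 'a) measure \<Rightarrow> ereal" where
  "ip_entropy X \<mu> = (SUP P\<in>{P. measurable_partition X P}. ip_entropy_partition X \<mu> P)"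

definition restriction_map :: "(nat \<Rightarrow> nat) \<Rightarrow> (nat \<Rightarrow> 'a) \<Rightarrow> (nat \<Rightarrow> 'a)" where
  "restriction_map r x = (\<lambda>n. x (r n))"

text \<open>\<^const>\<open>distr\<close> is the push-forward only along measurable maps.\<close>

lemma measurable_restriction_map:
  "restriction_map r \<in> seq_space X \<rightarrow>\<^sub>M seq_space X"
proof (rule measurable_PiM_single')
  show "(\<lambda>x. restriction_map r x n) \<in> seq_space X \<rightarrow>\<^sub>M X" for n
    unfolding restriction_map_def by (rule measurable_component_singleton) simp
  show "restriction_map r \<in> space (seq_space X) \<rightarrow> (\<Pi>\<^sub>E n\<in>UNIV. space X)"
    by (auto simp: restriction_map_def space_PiM PiE_iff)
qed

lemma measurable_partition_cylinder_partition:
  assumes P: "measurable_partition X P"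
  shows "measurable_partition (seq_space X) (cylinder_partition X n P)"
proof -
  have mem: "x \<in> cylinder X n A \<longleftrightarrow> (\<forall>i. x i \<in> (if i < n then A i else space X))" for x A
    by (simp add: cylinder_def PiE_iff)
  have P': "finite P" "P \<subseteq> sets X" "disjoint P" "\<Union>P = space X"
    using P by (auto simp: measurable_partition_def)
  have "cylinder_partition X n P \<subseteq> cylinder X n ` ({..<n} \<rightarrow>\<^sub>E P)"
  proof
    fix C assume "C \<in> cylinder_partition X n P"
    then obtain A where A: "C = cylinder X n A" "\<forall>i<n. A i \<in> P"
      by (auto simp: cylinder_partition_def)
    have "C = cylinder X n (restrict A {..<n})"
      unfolding A(1) cylinder_def by (intro PiE_cong) auto
    then show "C \<in> cylinder X n ` ({..<n} \<rightarrow>\<^sub>E P)" using A(2) by auto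
  qed
  then have "finite (cylinder_partition X n P)"
    by (rule finite_subset) (auto intro!: finite_PiE P')
  moreover have "cylinder_partition X n P \<subseteq> sets (seq_space X)"
  proof
    fix C assume "C \<in> cylinder_partition X n P"
    then obtain A where A: "C = cylinder X n A" "\<forall>i<n. A i \<in> P"
      by (auto simp: cylinder_partition_def)
    show "C \<in> sets (seq_space X)"
      unfolding A(1) cylinder_def using A(2) P'(2)
      by (intro sets_PiM_I_countable) auto
  qed
  moreover have "disjoint (cylinder_partition X n P)"
  proof (rule disjointI)
    fix C D assume "C \<in> cylinder_partition X n P" "D \<in> cylinder_partition X n P" and ne: "C \<noteq> D"
    then obtain A B where A: "C = cylinder X n A" "\<forall>i<n. A i \<in> P"
      and B: "D = cylinder X n B" "\<forall>i<n. B i \<in> P"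
      by (auto simp: cylinder_partition_def)
    have "\<exists>i<n. A i \<noteq> B i"
    proof (rule ccontr)
      assume "\<not> (\<exists>i<n. A i \<noteq> B i)"
      then have "C = D" unfolding A(1) B(1) cylinder_def by (intro PiE_cong) auto
      with ne show False by simp
    qed
    then obtain i where i: "i < n" "A i \<noteq> B i" by blast
    then have "A i \<inter> B i = {}" using A(2) B(2) P'(3) by (auto dest: disjointD)
    moreover have "x i \<in> A i" if "x \<in> C" for x
      using that i(1) unfolding A(1) mem by (auto dest!: spec[of _ i])
    moreover have "x i \<in> B i" if "x \<in> D" for x
      using that i(1) unfolding B(1) mem by (auto dest!: spec[of _ i])
    ultimately show "C \<inter> D = {}" by blast
  qed
  moreover have "\<Union>(cylinder_partition X n P) = space (seq_space X)"
  proof (intro equalityI subsetI)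
    fix x assume "x \<in> \<Union>(cylinder_partition X n P)"
    then obtain A where A: "x \<in> cylinder X n A" "\<forall>i<n. A i \<in> P"
      by (auto simp: cylinder_partition_def)
    have "x i \<in> space X" for i
      using A P'(4) unfolding mem by (cases "i < n") (auto dest!: spec[of _ i])
    then show "x \<in> space (seq_space X)" by (simp add: space_PiM PiE_iff)
  next
    fix x assume "x \<in> space (seq_space X)"
    then have x: "x i \<in> space X" for i by (simp add: space_PiM PiE_iff)
    then have "\<forall>i. \<exists>A\<in>P. x i \<in> A" using P'(4) by blast
    then obtain A where A: "\<And>i. A i \<in> P" "\<And>i. x i \<in> A i" by metis
    then have "x \<in> cylinder X n A" using x by (simp add: mem)
    then show "x \<in> \<Union>(cylinder_partition X n P)"
      using A(1) by (auto simp: cylinder_partition_def)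
  qed
  ultimately show ?thesis by (simp add: measurable_partition_def)
qed

end

theory Submission
  imports Defs
begin

text \<open>
  Since \<open>r i < n k\<close> for \<open>i < n\<close>, every cylinder of length \<open>n k\<close> is mapped by the restriction map into
  a single cylinder of length \<open>n\<close>. Entropy does not increase under coarsening, so the entropy of the
  push-forward at length \<open>n\<close> is at most that of \<open>\<mu>\<close> at length \<open>n k\<close>; dividing by \<open>n\<close> gives the factor
  \<open>k\<close>, and the limsup along multiples of \<open>k\<close> is at most the full limsup.
\<close>

text \<open>Up to null sets, \<open>P\<close> refines the pullback of \<open>Q\<close> along
  \<open>f\<close>. Replacing \<open>ln\<close> of the mass of a cell of \<open>P\<close> by
  \<open>ln\<close> of the larger mass of the cell of \<open>Q\<close> that receives it can only
  increase the sum; grouping by receiving cell then gives the sum for \<open>Q\<close>. The minus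
  sign in the entropy reverses the inequality.\<close>

lemma shannon_entropy_distr_le:
  assumes "prob_space M" and f: "f \<in> M \<rightarrow>\<^sub>M N"
    and P: "measurable_partition M P" and Q: "measurable_partition N Q"
    and refines: "\<And>A. A \<in> P \<Longrightarrow> \<exists>B\<in>Q. f ` A \<subseteq> B"
  shows "shannon_entropy (distr M N f) Q \<le> shannon_entropy M P"
proof -
  interpret prob_space M by fact
  let ?m = "measure (distr M N f)"
  have P': "finite P" "P \<subseteq> sets M" "disjoint P" "\<Union>P = space M"
    and Q': "finite Q" "Q \<subseteq> sets N" "disjoint Q"
    using P Q by (auto simp: measurable_partition_def)
  \<comment> \<open>\<open>g\<close> selects a receiving cell. For empty \<open>A\<close> the choice
    is arbitrary, but such an \<open>A\<close> has measure 0.\<close>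
  obtain g where g: "\<And>A. A \<in> P \<Longrightarrow> g A \<in> Q" "\<And>A. A \<in> P \<Longrightarrow> f ` A \<subseteq> g A"
    using refines by metis
  have m: "?m B = measure M (f -` B \<inter> space M)" if "B \<in> Q" for B
    using that Q'(2) f by (auto intro!: measure_distr)
  have fibre: "?m B = (\<Sum>A\<in>{A\<in>P. g A = B}. measure M A)" if B: "B \<in> Q" for B
  proof -
    have "\<Union>{A\<in>P. g A = B} \<subseteq> f -` B \<inter> space M"
      using P'(4) g(2) by blast
    moreover have "f -` B \<inter> space M \<subseteq> \<Union>{A\<in>P. g A = B}"
    proof
      fix x assume x: "x \<in> f -` B \<inter> space M"
      then obtain A where A: "A \<in> P" "x \<in> A" using P'(4) by blast
      then have "f x \<in> g A \<inter> B" using x g(2) by blast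
      then have "g A = B" using g(1)[OF A(1)] B Q'(3) by (auto dest: disjointD)
      then show "x \<in> \<Union>{A\<in>P. g A = B}" using A by blast
    qed
    ultimately have "f -` B \<inter> space M = \<Union>{A\<in>P. g A = B}" by blast
    moreover have "measure M (\<Union>{A\<in>P. g A = B}) = (\<Sum>A\<in>{A\<in>P. g A = B}. measure M A)"
      using P' by (intro measure_Union')
        (auto simp: disjnt_def pairwise_def fmeasurable_eq_sets dest: disjointD)
    ultimately show ?thesis using m[OF B] by simp
  qed
  have "(\<Sum>A\<in>P. measure M A * ln (measure M A)) \<le> (\<Sum>A\<in>P. measure M A * ln (?m (g A)))"
  proof (rule sum_mono)
    fix A assume A: "A \<in> P"
    have "f -` g A \<inter> space M \<in> sets M"
      using f g(1)[OF A] Q'(2) by (auto intro: measurable_sets)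
    then have "measure M A \<le> ?m (g A)"
      unfolding m[OF g(1)[OF A]] using A P'(4) g(2)[OF A] by (intro finite_measure_mono) auto
    \<comment> \<open>\<open>ln\<close> is monotone on positive arguments; when \<open>A\<close> is
      null, both products vanish.\<close>
    then show "measure M A * ln (measure M A) \<le> measure M A * ln (?m (g A))"
      by (cases "measure M A = 0") (auto intro!: mult_left_mono ln_mono simp: zero_less_measure_iff)
  qed
  \<comment> \<open>A cell of \<open>Q\<close> outside the range of \<open>g\<close> contributes an
    empty sum, in agreement with its mass 0 by \<open>fibre\<close>.\<close>
  also have "\<dots> = (\<Sum>B\<in>Q. \<Sum>A\<in>{A\<in>P. g A = B}. measure M A * ln (?m (g A)))"
    using g(1) by (intro sum.group[symmetric] P' Q') auto
  also have "\<dots> = (\<Sum>B\<in>Q. ?m B * ln (?m B))"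
    by (intro sum.cong refl) (simp add: fibre sum_distrib_right)
  finally show ?thesis by (simp add: shannon_entropy_def)
qed

text \<open>Coordinate \<open>i\<close> of the image is coordinate \<open>r i\<close> of the point,
  and \<open>r i < m\<close> means that \<open>C\<close> already confines it to
  \<open>A (r i)\<close>. So the base sets of the target cylinder are
  \<open>A (r i)\<close>.\<close>

lemma cylinder_partition_restriction_refines:
  assumes P: "\<Union>P = space X" and r: "\<And>i. i < n \<Longrightarrow> r i < m"
    and C: "C \<in> cylinder_partition X m P"
  shows "\<exists>D\<in>cylinder_partition X n P. restriction_map r ` C \<subseteq> D"
proof -
  obtain A where A: "C = cylinder X m A" "\<forall>i<m. A i \<in> P"
    using C by (auto simp: cylinder_partition_def)
  have "restriction_map r x \<in> cylinder X n (\<lambda>i. A (r i))" if "x \<in> C" for x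
  proof -
    have x: "x j \<in> (if j < m then A j else space X)" for j
      using that A(1) by (auto simp: cylinder_def PiE_iff)
    \<comment> \<open>Coordinates of the image from \<open>n\<close> on may still be read from
      constrained positions \<open>j < m\<close>; there the cell \<open>A j\<close> lies in
      \<open>space X\<close>.\<close>
    then have "x j \<in> space X" for j
      using A(2) P by (metis Union_iff)
    moreover have "x (r i) \<in> A (r i)" if "i < n" for i
      using x[of "r i"] r[OF that] by simp
    ultimately show ?thesis
      by (simp add: cylinder_def PiE_iff restriction_map_def)
  qed
  moreover have "cylinder X n (\<lambda>i. A (r i)) \<in> cylinder_partition X n P"
    using A(2) r by (auto simp: cylinder_partition_def)
  ultimately show ?thesis by blast
qed

text \<open>The dilated average is \<open>k\<close> times the ordinary average at index
  \<open>n * k\<close>, and \<open>n * k\<close> runs through a subsequence because \<open>k\<close>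
  is positive. At \<open>n = 0\<close> both sides are 0, since division by zero yields 0.\<close>

lemma limsup_average_dilate:
  fixes b :: "nat \<Rightarrow> real"
  assumes k: "k \<ge> 1"
  shows "limsup (\<lambda>n. ereal (1 / real n * b (n * k)))
    \<le> ereal (real k) * limsup (\<lambda>n. ereal (1 / real n * b n))"
proof -
  let ?u = "\<lambda>n. ereal (1 / real n * b n)"
  have "limsup (\<lambda>n. ereal (1 / real n * b (n * k)))
      = limsup (\<lambda>n. ereal (real k) * (?u \<circ> (\<lambda>n. n * k)) n)"
    using k by (intro arg_cong[where f = limsup]) (auto simp: fun_eq_iff)
  also have "\<dots> = ereal (real k) * limsup (?u \<circ> (\<lambda>n. n * k))"
    by (rule Limsup_ereal_mult_left) auto
  also have "\<dots> \<le> ereal (real k) * limsup ?u"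
    using k by (intro ereal_mult_left_mono limsup_subseq_mono) (auto simp: strict_mono_def)
  finally show ?thesis .
qed

theorem proposition2p6:
  fixes X :: "'a measure" and r :: "nat \<Rightarrow> nat" and k :: nat
    and \<mu> :: "(nat \<Rightarrow> 'a) measure"
  assumes "strict_mono r"
    and "k \<ge> 1"
    and "\<And>n. r n \<le> (n + 1) * k - 1"
    and "prob_space \<mu>"
    and "sets \<mu> = sets (seq_space X)"
  shows "ip_entropy X (distr \<mu> (seq_space X) (restriction_map r)) \<le> ereal (real k) * ip_entropy X \<mu>"
proof -
  let ?\<nu> = "distr \<mu> (seq_space X) (restriction_map r)"
  have r: "r i < n * k" if "i < n" for i n
  proof -
    have "(i + 1) * k \<le> n * k" using that by (intro mult_le_mono1) simp
    \<comment> \<open>Positivity keeps the natural-number subtraction in the bound on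
      \<open>r\<close> from truncating, so the bound becomes strict.\<close>
    moreover have "0 < (i + 1) * k" using assms(2) by simp
    ultimately show ?thesis using assms(3)[of i] by linarith
  qed
  have meas: "restriction_map r \<in> \<mu> \<rightarrow>\<^sub>M seq_space X"
    using measurable_restriction_map measurable_cong_sets[OF assms(5) refl] by blast
  have "ip_entropy_partition X ?\<nu> P \<le> ereal (real k) * ip_entropy X \<mu>"
    if P: "measurable_partition X P" for P
  proof -
    have part: "measurable_partition \<mu> (cylinder_partition X n P)" for n
      using measurable_partition_cylinder_partition[OF P, of n] assms(5)
        sets_eq_imp_space_eq[OF assms(5)] by (simp add: measurable_partition_def)
    have "shannon_entropy ?\<nu> (cylinder_partition X n P)
        \<le> shannon_entropy \<mu> (cylinder_partition X (n * k) P)" for n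
      using P r by (intro shannon_entropy_distr_le assms(4) meas part
          measurable_partition_cylinder_partition cylinder_partition_restriction_refines)
        (auto simp: measurable_partition_def)
    then have "ip_entropy_partition X ?\<nu> P
        \<le> limsup (\<lambda>n. ereal (1 / real n * shannon_entropy \<mu> (cylinder_partition X (n * k) P)))"
      unfolding ip_entropy_partition_def
      \<comment> \<open>The comparison holds at every \<open>n\<close>, including
        \<open>n = 0\<close>, where both averages are 0.\<close>
      by (intro Limsup_mono always_eventually allI) (simp add: divide_right_mono)
    also have "\<dots> \<le> ereal (real k) * ip_entropy_partition X \<mu> P"
      unfolding ip_entropy_partition_def by (rule limsup_average_dilate[OF assms(2)])
    also have "\<dots> \<le> ereal (real k) * ip_entropy X \<mu>"
      unfolding ip_entropy_def using P by (intro ereal_mult_left_mono SUP_upper) auto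
    finally show ?thesis .
  qed
  then show ?thesis
    unfolding ip_entropy_def[of X ?\<nu>] by (intro SUP_least) simp
qed

end
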